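(* Let $(X,\varphi)$ and $(Y,\psi)$ be two size pairs, with $X,Y$ closed curves of class $C^2$, and $\varphi:X\to\mathbb{R}$, $\psi:Y\to\mathbb{R}$ Morse measuring functions. If $\delta\left((X,\varphi),(Y,\psi)\right)=0$, then there exists an optimal homeomorphism $f:X\to Y$, i.e. a homeomorphism $f:X\to Y$ with $\max_{x\in X}|\varphi(x)-\psi(f(x))|=\delta\left((X,\varphi),(Y,\psi)\right)=0$.
   Context: A size pair is a pair $(X,\varphi)$, where $X$ is a non-empty, compact, locally connected Hausdorff space and $\varphi:X\to\mathbb{R}$ is a continuous function, called a measuring function. For size pairs $(X,\varphi)$, $(Y,\psi)$, let $H(X,Y)$ be the set of all homeomorphisms from $X$ to $Y$, and for $f\in H(X,Y)$ put $\Theta(f)=\max_{x\in X}|\varphi(x)-\psi(f(x))|$. The natural pseudo-distance is $\delta\left((X,\varphi),(Y,\psi)\right)=\inf_{f\in H(X,Y)}\Theta(f)$ if $H(X,Y)\neq\emptyset$, and $+\infty$ otherwise. A homeomorphism $f\in H(X,Y)$ is called optimal if $\Theta(f)=\delta\left((X,\varphi),(Y,\psi)\right)$. A closed curve is a compact $1$-manifold without boundary. A measuring function on a closed curve of class $C^2$ is Morse if it is smooth (meaning at least of class $C^2$, as makes sense on a $C^2$ manifold) and its Hessian at each critical point is invertible, i.e. in a local coordinate its second derivative is non-zero wherever its first derivative vanishes. *)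

theory Defs
  imports "HOL-Analysis.Analysis"
begin

definition C2_on :: "real set \<Rightarrow> (real \<Rightarrow> real) \<Rightarrow> bool" where
  "C2_on S g \<longleftrightarrow>
     (\<forall>t\<in>S. g differentiable (at t)) \<and>
     (\<forall>t\<in>S. deriv g differentiable (at t)) \<and>
     continuous_on S (deriv (deriv g))"

type_synonym 'a chart = "'a set \<times> ('a \<Rightarrow> real)"

text \<open>Only the values of \<open>h\<close> on \<open>U\<close> matter. The image is open in the real line, so the
  charts are those of a manifold without boundary.\<close>

definition is_chart :: "'a topology \<Rightarrow> 'a chart \<Rightarrow> bool" where
  "is_chart X c \<longleftrightarrow> (case c of (U, h) \<Rightarrow>
     openin X U \<and> open (h ` U) \<and>
     homeomorphic_map (subtopology X U) (top_of_set (h ` U)) h)"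

text \<open>The expression of \<open>g\<close> in the chart \<open>(U, h)\<close>, meaningful on the open set \<open>h ` U\<close> only.\<close>

definition local_expr :: "'a chart \<Rightarrow> ('a \<Rightarrow> real) \<Rightarrow> real \<Rightarrow> real" where
  "local_expr c g = (case c of (U, h) \<Rightarrow> g \<circ> inv_into U h)"

text \<open>Pairs of charts are taken in both orders, so each transition map and its inverse are
  of class \<open>C\<^sup>2\<close>.\<close>

definition C2_atlas :: "'a topology \<Rightarrow> 'a chart set \<Rightarrow> bool" where
  "C2_atlas X A \<longleftrightarrow>
     (\<forall>c\<in>A. is_chart X c) \<and>
     (\<Union>c\<in>A. fst c) = topspace X \<and>
     (\<forall>c\<in>A. \<forall>d\<in>A. C2_on (snd c ` (fst c \<inter> fst d)) (local_expr c (snd d)))"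

text \<open>Connectedness is not required: a compact 1-manifold may have several components.
  The atlas need not be maximal.\<close>

definition C2_closed_curve :: "'a topology \<Rightarrow> 'a chart set \<Rightarrow> bool" where
  "C2_closed_curve X A \<longleftrightarrow>
     Hausdorff_space X \<and> second_countable X \<and> compact_space X \<and> C2_atlas X A"

definition Morse :: "'a chart set \<Rightarrow> ('a \<Rightarrow> real) \<Rightarrow> bool" where
  "Morse A \<phi> \<longleftrightarrow> (\<forall>c\<in>A.
     C2_on (snd c ` fst c) (local_expr c \<phi>) \<and>
     (\<forall>t \<in> snd c ` fst c. deriv (local_expr c \<phi>) t = 0 \<longrightarrow>
        deriv (deriv (local_expr c \<phi>)) t \<noteq> 0))"

definition size_pair :: "'a topology \<Rightarrow> ('a \<Rightarrow> real) \<Rightarrow> bool" where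
  "size_pair X \<phi> \<longleftrightarrow>
     topspace X \<noteq> {} \<and> compact_space X \<and> locally_connected_space X \<and> Hausdorff_space X \<and>
     continuous_map X euclideanreal \<phi>"

definition homeos :: "'a topology \<Rightarrow> 'b topology \<Rightarrow> ('a \<Rightarrow> 'b) set" where
  "homeos X Y = {f. homeomorphic_map X Y f}"

text \<open>For size pairs and homeomorphisms this supremum is attained; see \<open>Theta_is_max\<close>.\<close>

definition Theta :: "'a topology \<Rightarrow> ('a \<Rightarrow> real) \<Rightarrow> ('b \<Rightarrow> real) \<Rightarrow> ('a \<Rightarrow> 'b) \<Rightarrow> real" where
  "Theta X \<phi> \<psi> f = (SUP x\<in>topspace X. \<bar>\<phi> x - \<psi> (f x)\<bar>)"

definition natural_pseudo_distance ::
  "'a topology \<Rightarrow> ('a \<Rightarrow> real) \<Rightarrow> 'b topology \<Rightarrow> ('b \<Rightarrow> real) \<Rightarrow> ereal" where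
  "natural_pseudo_distance X \<phi> Y \<psi> =
     (if homeos X Y \<noteq> {} then ereal (INF f\<in>homeos X Y. Theta X \<phi> \<psi> f) else \<infinity>)"

definition optimal_homeo ::
  "'a topology \<Rightarrow> ('a \<Rightarrow> real) \<Rightarrow> 'b topology \<Rightarrow> ('b \<Rightarrow> real) \<Rightarrow> ('a \<Rightarrow> 'b) \<Rightarrow> bool" where
  "optimal_homeo X \<phi> Y \<psi> f \<longleftrightarrow>
     f \<in> homeos X Y \<and> ereal (Theta X \<phi> \<psi> f) = natural_pseudo_distance X \<phi> Y \<psi>"

lemma Theta_is_max:
  assumes X: "size_pair X \<phi>" and Y: "size_pair Y \<psi>" and f: "f \<in> homeos X Y"
  shows "\<exists>x\<in>topspace X. Theta X \<phi> \<psi> f = \<bar>\<phi> x - \<psi> (f x)\<bar> \<and>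
    (\<forall>y\<in>topspace X. \<bar>\<phi> y - \<psi> (f y)\<bar> \<le> \<bar>\<phi> x - \<psi> (f x)\<bar>)"
proof -
  let ?g = "\<lambda>x. \<bar>\<phi> x - \<psi> (f x)\<bar>"
  have "continuous_map X Y f"
    using f by (simp add: homeos_def homeomorphic_imp_continuous_map)
  then have "continuous_map X euclideanreal (\<psi> \<circ> f)"
    using Y continuous_map_compose unfolding size_pair_def by blast
  then have "continuous_map X euclideanreal (\<lambda>x. \<psi> (f x))"
    by (simp add: o_def)
  then have "continuous_map X euclideanreal ?g"
    using X unfolding size_pair_def
    by (intro continuous_map_real_abs continuous_map_diff) auto
  moreover have "compactin X (topspace X)"
    using X by (simp add: size_pair_def compact_space_def)
  ultimately have "compact (?g ` topspace X)"
    using image_compactin by fastforce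
  moreover have "?g ` topspace X \<noteq> {}"
    using X by (simp add: size_pair_def)
  ultimately obtain x where x: "x \<in> topspace X" "\<forall>y\<in>topspace X. ?g y \<le> ?g x"
    using compact_attains_sup[of "?g ` topspace X"] by blast
  then have "Theta X \<phi> \<psi> f = ?g x"
    unfolding Theta_def by (intro cSup_eq_maximum) auto
  with x show ?thesis by blast
qed

end

theory Submission
  imports Defs
begin

text \<open>
  If the pseudo-distance vanishes, there are homeomorphisms \<open>h n\<close> from \<open>X\<close> to \<open>Y\<close> that carry
  \<open>\<psi>\<close> to \<open>\<phi>\<close> up to an error below \<open>1 / (n + 1)\<close>, and the optimal homeomorphism is a limit of them.
  Homeomorphisms of curves need not accumulate at a homeomorphism: a sequence may stretch short arcs
  to long ones, or shrink long ones. The measuring functions forbid both. A Morse function on a closed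
  curve has finite fibres, because it takes each of its values at isolated points. So a connected set
  on which \<open>\<psi>\<close> is almost constant is close to a finite fibre, hence close to a single point of
  it (\<open>connected_near_fibre_subset_cover\<close>). Now \<open>h n\<close> maps a small connected neighbourhood of a
  point, where \<open>\<phi>\<close> is almost constant, to a connected set where \<open>\<psi>\<close> is almost constant, which is
  therefore small; and the inverse maps behave in the same way.

  This makes every pointwise cluster point \<open>f\<close> of the \<open>h n\<close>, which exists by Tychonoff's
  theorem, continuous (control of the \<open>h n\<close>) and injective (control of their inverses), with
  \<open>\<psi> \<circ> f = \<phi>\<close> (\<open>level_preserving_embedding\<close>). Exchanging the two pairs gives an embedding of \<open>Y\<close>
  in \<open>X\<close> with the corresponding property. Both embeddings map fibres to fibres, so corresponding
  fibres are finite sets with the same number of points, and \<open>f\<close> is onto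
  (\<open>level_preserving_homeomorphism\<close>). This part of the argument is
  purely topological and is stated for arbitrary size pairs with finite fibres.
\<close>

section \<open>Morse functions have finite fibres\<close>

lemma eventually_neq_of_nonzero_deriv:
  fixes F :: "real \<Rightarrow> real"
  assumes "F differentiable (at t)" and "deriv F t \<noteq> 0"
  shows "\<forall>\<^sub>F s in at t. F s \<noteq> F t"
proof -
  have "(F has_field_derivative deriv F t) (at t)"
    using assms(1) DERIV_deriv_iff_real_differentiable by blast
  then have "((\<lambda>s. (F s - F t) / (s - t)) \<longlongrightarrow> deriv F t) (at t)"
    by (simp add: has_field_derivative_iff)
  then have "\<forall>\<^sub>F s in at t. (F s - F t) / (s - t) \<noteq> 0"
    using assms(2) by (rule tendsto_imp_eventually_ne)
  then show ?thesis
    by eventually_elim auto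
qed

text \<open>At a critical point the second derivative makes the first one nonzero on a punctured interval,
  and a second point of that interval with the same value would contradict Rolle's theorem.\<close>

lemma eventually_neq_of_nondegenerate:
  fixes F :: "real \<Rightarrow> real"
  assumes C2: "C2_on T F" and "open T" "t \<in> T"
    and nondeg: "deriv F t = 0 \<longrightarrow> deriv (deriv F) t \<noteq> 0"
  shows "\<forall>\<^sub>F s in at t. F s \<noteq> F t"
proof (cases "deriv F t = 0")
  case False
  then show ?thesis
    using C2 \<open>t \<in> T\<close> by (intro eventually_neq_of_nonzero_deriv) (auto simp: C2_on_def)
next
  case True
  have "\<forall>\<^sub>F s in at t. deriv F s \<noteq> deriv F t"
    using C2 \<open>t \<in> T\<close> True nondeg
    by (intro eventually_neq_of_nonzero_deriv) (auto simp: C2_on_def)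
  moreover have "\<forall>\<^sub>F s in at t. s \<in> T"
    using \<open>open T\<close> \<open>t \<in> T\<close> by (rule eventually_at_in_open')
  ultimately have "\<forall>\<^sub>F s in at t. deriv F s \<noteq> 0 \<and> s \<in> T"
    unfolding True by (rule eventually_conj)
  then obtain e where "e > 0"
    and e: "\<And>s. s \<noteq> t \<Longrightarrow> \<bar>s - t\<bar> < e \<Longrightarrow> deriv F s \<noteq> 0 \<and> s \<in> T"
    by (auto simp: eventually_at dist_real_def)
  have eT: "s \<in> T" if "\<bar>s - t\<bar> < e" for s
    using e[OF _ that] \<open>t \<in> T\<close> by (cases "s = t") auto
  \<comment> \<open>Stated for an interval \<open>[a, b]\<close> on either side of \<open>t\<close>; one of its endpoints will be \<open>t\<close>.\<close>
  have no_return: False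
    if ab: "a < b" "F a = F b" "\<bar>a - t\<bar> < e" "\<bar>b - t\<bar> < e" "t \<le> a \<or> b \<le> t" for a b
  proof -
    have diff: "F differentiable (at s)" if "a \<le> s" "s \<le> b" for s
      using eT[of s] that ab C2 by (auto simp: C2_on_def)
    then have "continuous_on {a..b} F"
      by (intro continuous_at_imp_continuous_on ballI differentiable_imp_continuous_within) auto
    then obtain z where z: "a < z" "z < b" "(F has_real_derivative 0) (at z)"
      using Rolle[OF ab(1,2)] diff less_imp_le by blast
    then have "deriv F z = 0"
      by (simp add: DERIV_imp_deriv)
    moreover have "deriv F z \<noteq> 0"
      using e[of z] z ab by auto
    ultimately show False by blast
  qed
  have "F s \<noteq> F t" if "s \<noteq> t" "dist s t < e" for s
    using no_return[of s t] no_return[of t s] that \<open>e > 0\<close>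
    by (cases "s < t") (auto simp: dist_real_def)
  then show ?thesis
    using \<open>e > 0\<close> unfolding eventually_at by blast
qed

lemma Morse_isolated_in_fibre:
  assumes "C2_atlas X A" "Morse A \<phi>" "x \<in> topspace X"
  obtains N where "openin X N" "x \<in> N" "\<And>y. y \<in> N \<Longrightarrow> y \<noteq> x \<Longrightarrow> \<phi> y \<noteq> \<phi> x"
proof -
  have "x \<in> (\<Union>c\<in>A. fst c)"
    using assms(1,3) unfolding C2_atlas_def by blast
  then obtain c where "c \<in> A" "x \<in> fst c"
    by blast
  then obtain U h where Uh: "(U, h) \<in> A" "x \<in> U"
    by (cases c) auto
  have "is_chart X (U, h)"
    using assms(1) Uh(1) unfolding C2_atlas_def by blast
  then have U: "openin X U" "open (h ` U)"
    and hom: "homeomorphic_map (subtopology X U) (top_of_set (h ` U)) h"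
    by (auto simp: is_chart_def)
  have UX: "U \<subseteq> topspace X"
    using U(1) by (rule openin_subset)
  then have inj: "inj_on h U"
    using homeomorphic_imp_injective_map[OF hom] by (simp add: topspace_subtopology Int_absorb1)
  define F where "F = \<phi> \<circ> inv_into U h"
  have F: "F (h y) = \<phi> y" if "y \<in> U" for y
    using that inj by (simp add: F_def)
  have "C2_on (h ` U) F"
    and "\<forall>t\<in>h ` U. deriv F t = 0 \<longrightarrow> deriv (deriv F) t \<noteq> 0"
    using assms(2) Uh(1) by (auto simp: Morse_def local_expr_def F_def)
  then have "\<forall>\<^sub>F s in at (h x). F s \<noteq> F (h x)"
    using U(2) Uh(2) eventually_neq_of_nondegenerate[of "h ` U" F "h x"] by blast
  then obtain G where G: "open G" "h x \<in> G" "\<And>s. s \<in> G \<Longrightarrow> s \<noteq> h x \<Longrightarrow> F s \<noteq> F (h x)"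
    by (auto simp: eventually_at_topological)
  define N where "N = {y \<in> topspace (subtopology X U). h y \<in> G}"
  have "continuous_map (subtopology X U) euclideanreal h"
    using homeomorphic_imp_continuous_map[OF hom] by (simp add: continuous_map_in_subtopology)
  then have "openin (subtopology X U) N"
    unfolding N_def using G(1) by (intro openin_continuous_map_preimage) auto
  then have "openin X N"
    using U(1) openin_trans_full by blast
  moreover have "x \<in> N"
    using Uh(2) UX G(2) by (auto simp: N_def)
  moreover have "\<phi> y \<noteq> \<phi> x" if "y \<in> N" "y \<noteq> x" for y
  proof -
    have "y \<in> U" "h y \<in> G" using that by (auto simp: N_def)
    moreover have "h y \<noteq> h x" using inj \<open>y \<in> U\<close> Uh(2) that by (auto dest: inj_onD)
    ultimately show ?thesis using G(3)[of "h y"] F Uh(2) by auto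
  qed
  ultimately show thesis using that by blast
qed

text \<open>An infinite fibre would accumulate somewhere by compactness, and at a point of the fibre, since
  fibres are closed; but the points of a fibre are isolated in it.\<close>

lemma Morse_finite_fibres:
  assumes "compact_space X" "continuous_map X euclideanreal \<phi>" "C2_atlas X A" "Morse A \<phi>"
  shows "finite {x \<in> topspace X. \<phi> x = c}" (is "finite ?Z")
proof (rule ccontr)
  assume "infinite ?Z"
  then have "X derived_set_of ?Z \<noteq> {}"
    using assms(1) by (intro compact_space_imp_Bolzano_Weierstrass) auto
  then obtain x where x: "x \<in> X derived_set_of ?Z"
    by blast
  have "closedin X {x \<in> topspace X. \<phi> x \<in> {c}}"
    using assms(2) by (intro closedin_continuous_map_preimage) auto
  then have "x \<in> ?Z"
    using x by (auto simp: closedin_contains_derived_set)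
  then obtain N where N: "openin X N" "x \<in> N" "\<And>y. y \<in> N \<Longrightarrow> y \<noteq> x \<Longrightarrow> \<phi> y \<noteq> \<phi> x"
    using Morse_isolated_in_fibre[OF assms(3,4)] by blast
  then obtain y where "y \<noteq> x" "y \<in> ?Z" "y \<in> N"
    using x unfolding in_derived_set_of by blast
  then show False using N(3) \<open>x \<in> ?Z\<close> by auto
qed

section \<open>Connected sets on which the measuring function is almost constant\<close>

text \<open>This replaces a bound on the diameter: for the cover by \<open>V\<close> and \<open>V'\<close>, a connected set on which
  \<open>\<psi>\<close> stays near \<open>c\<close> is small enough to lie in one member. The finite fibre over \<open>c\<close>
  splits into two closed parts that have disjoint open neighbourhoods, inside \<open>V\<close> and inside \<open>V'\<close>. By
  compactness \<open>\<psi>\<close> stays away from \<open>c\<close> outside these neighbourhoods, so the connected set is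
  covered by two disjoint open sets.\<close>

lemma connected_near_fibre_subset_cover:
  assumes Y: "compact_space Y" "Hausdorff_space Y" and \<psi>: "continuous_map Y euclideanreal \<psi>"
    and fin: "finite {y \<in> topspace Y. \<psi> y = c}"
    and V: "openin Y V" "openin Y V'" "topspace Y \<subseteq> V \<union> V'"
  obtains d :: real where "d > 0"
    "\<And>C. connectedin Y C \<Longrightarrow> (\<And>y. y \<in> C \<Longrightarrow> \<bar>\<psi> y - c\<bar> < d) \<Longrightarrow> C \<subseteq> V \<or> C \<subseteq> V'"
proof -
  let ?Z = "{y \<in> topspace Y. \<psi> y = c}"
  have "finite (?Z \<inter> V)" "finite (?Z - V)"
    using fin by auto
  then have "closedin Y (?Z \<inter> V) \<and> closedin Y (?Z - V) \<and> disjnt (?Z \<inter> V) (?Z - V)"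
    using Y(2) by (auto intro!: closedin_Hausdorff_finite simp: disjnt_def)
  moreover have "normal_space Y"
    using Y by (intro compact_Hausdorff_or_regular_imp_normal_space) auto
  ultimately have "\<exists>P Q. openin Y P \<and> openin Y Q \<and> ?Z \<inter> V \<subseteq> P \<and> ?Z - V \<subseteq> Q \<and> disjnt P Q"
    unfolding normal_space_def by (elim allE impE)
  then obtain P Q where PQ: "openin Y P" "openin Y Q" "?Z \<inter> V \<subseteq> P" "?Z - V \<subseteq> Q" "disjnt P Q"
    by (elim exE conjE)
  define P' where "P' = P \<inter> V"
  define Q' where "Q' = Q \<inter> V'"
  have P': "openin Y P'" "openin Y Q'" "P' \<inter> Q' = {}" "?Z \<subseteq> P' \<union> Q'"
    using PQ V by (auto simp: P'_def Q'_def disjnt_def)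
  define K where "K = \<psi> ` (topspace Y - (P' \<union> Q'))"
  have "closedin Y (topspace Y - (P' \<union> Q'))"
    using P' by auto
  then have "compactin Y (topspace Y - (P' \<union> Q'))"
    using Y(1) closedin_compact_space by blast
  then have "compact K"
    using image_compactin \<psi> unfolding K_def by fastforce
  then have "open (- K)"
    by (simp add: compact_imp_closed open_Compl)
  moreover have "c \<in> - K"
    using P'(4) by (auto simp: K_def)
  ultimately obtain d where d: "d > 0" "\<And>r. dist r c < d \<Longrightarrow> r \<notin> K"
    unfolding open_dist by (metis ComplD)
  show thesis
  proof (rule that[OF d(1)])
    fix C assume C: "connectedin Y C" and near: "\<And>y. y \<in> C \<Longrightarrow> \<bar>\<psi> y - c\<bar> < d"
    have "C \<subseteq> P' \<union> Q'"
    proof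
      fix y assume "y \<in> C"
      then have "y \<in> topspace Y" "\<psi> y \<notin> K"
        using near d(2) connectedin_subset_topspace[OF C] by (auto simp: dist_real_def)
      then show "y \<in> P' \<union> Q'"
        by (auto simp: K_def)
    qed
    then have "P' \<inter> C = {} \<or> Q' \<inter> C = {}"
      using C P'(1-3) unfolding connectedin by blast
    then show "C \<subseteq> V \<or> C \<subseteq> V'"
      using \<open>C \<subseteq> P' \<union> Q'\<close> by (auto simp: P'_def Q'_def)
  qed
qed

section \<open>The limit map\<close>

text \<open>Tychonoff's theorem for the product of copies of \<open>Y\<close> indexed by \<open>I\<close>. A cluster point is enough
  below, so the product need not be sequentially compact.\<close>

lemma pointwise_cluster_map:
  fixes h :: "nat \<Rightarrow> 'a \<Rightarrow> 'b"
  assumes Y: "compact_space Y" and h: "\<And>n. h n ` I \<subseteq> topspace Y"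
  obtains f where "f \<in> I \<rightarrow> topspace Y"
    "\<And>n J V. finite J \<Longrightarrow> J \<subseteq> I \<Longrightarrow> (\<And>i. i \<in> J \<Longrightarrow> openin Y (V i) \<and> f i \<in> V i) \<Longrightarrow>
       \<exists>m\<ge>n. \<forall>i\<in>J. h m i \<in> V i"
proof -
  let ?P = "product_topology (\<lambda>_. Y) I"
  define S where "S n = {restrict (h m) I | m. m \<ge> n}" for n
  have S: "S n \<subseteq> topspace ?P" for n
    using image_subset_iff[THEN iffD1, OF h] by (auto simp: S_def)
  have "compact_space ?P"
    using Y by (simp add: compact_space_product_topology)
  moreover have "?P closure_of S n \<noteq> {}" for n
  proof -
    have "restrict (h n) I \<in> S n" by (auto simp: S_def)
    then show ?thesis using closure_of_subset[OF S] by blast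
  qed
  moreover have "decseq (\<lambda>n. ?P closure_of S n)"
    unfolding decseq_def by (intro allI impI closure_of_mono) (auto simp: S_def)
  ultimately have "(\<Inter>n. ?P closure_of S n) \<noteq> {}"
    by (intro compact_space_imp_nest) auto
  then obtain f where f: "\<And>n. f \<in> ?P closure_of S n"
    by blast
  have fP: "f \<in> topspace ?P"
    using f[of 0] by (simp add: in_closure_of)
  have cluster: "\<exists>m\<ge>n. \<forall>i\<in>J. h m i \<in> V i"
    if J: "finite J" "J \<subseteq> I" and V: "\<And>i. i \<in> J \<Longrightarrow> openin Y (V i) \<and> f i \<in> V i" for n J V
  proof -
    \<comment> \<open>The basic open set of the product that constrains the coordinates in \<open>J\<close> only.\<close>
    define W where "W i = (if i \<in> J then V i else topspace Y)" for i
    have "finite {i \<in> I. W i \<noteq> topspace Y}"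
      using J(1) by (rule finite_subset[rotated]) (auto simp: W_def)
    then have "openin ?P (PiE I W)"
      using V by (auto simp: openin_PiE_gen W_def)
    moreover have "f \<in> PiE I W"
      using fP V by (auto simp: W_def PiE_iff)
    ultimately obtain g where "g \<in> S n" "g \<in> PiE I W"
      using f[of n] unfolding in_closure_of by blast
    then obtain m where "m \<ge> n" "restrict (h m) I \<in> PiE I W"
      by (auto simp: S_def)
    then have "\<forall>i\<in>J. h m i \<in> V i"
      using J(2) by (auto simp: W_def PiE_iff split: if_splits)
    then show ?thesis using \<open>m \<ge> n\<close> by blast
  qed
  have "f \<in> I \<rightarrow> topspace Y"
    using fP by auto
  then show thesis
    using cluster by (rule that)
qed

lemma connected_neighbourhood_small_oscillation:
  assumes "size_pair X \<phi>" "x \<in> topspace X" "d > 0"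
  obtains N where "openin X N" "connectedin X N" "x \<in> N" "\<And>z. z \<in> N \<Longrightarrow> \<bar>\<phi> z - \<phi> x\<bar> < d"
proof -
  define V where "V = {z \<in> topspace X. \<phi> z \<in> ball (\<phi> x) d}"
  have "openin X V"
    using assms(1) unfolding V_def size_pair_def
    by (intro openin_continuous_map_preimage[of X euclideanreal]) auto
  moreover have "x \<in> V"
    using assms(2,3) by (simp add: V_def)
  moreover have "locally_connected_space X"
    using assms(1) by (simp add: size_pair_def)
  ultimately obtain N where "openin X N" "connectedin X N" "x \<in> N" "N \<subseteq> V"
    unfolding locally_connected_space by blast
  moreover have "\<bar>\<phi> z - \<phi> x\<bar> < d" if "z \<in> V" for z
    using that by (simp add: V_def dist_real_def abs_minus_commute)
  ultimately show thesis
    using that by blast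
qed

text \<open>The map is a pointwise cluster point \<open>f\<close> of the \<open>h n\<close>. It is continuous at \<open>x\<close> because a
  small connected neighbourhood of \<open>x\<close> has a connected image under \<open>h m\<close>, on which \<open>\<psi>\<close> varies
  little. It is injective because, if \<open>f x = f x'\<close>, the map \<open>k m\<close> sends a small connected neighbourhood of
  this common value to a connected set that contains \<open>x\<close> and \<open>x'\<close> and on which \<open>\<phi>\<close> varies
  little.\<close>

lemma level_preserving_embedding:
  fixes h :: "nat \<Rightarrow> 'a \<Rightarrow> 'b"
  assumes X: "size_pair X \<phi>" "\<And>c. finite {x \<in> topspace X. \<phi> x = c}"
    and Y: "size_pair Y \<psi>" "\<And>c. finite {y \<in> topspace Y. \<psi> y = c}"
    and hk: "\<And>n. homeomorphic_maps X Y (h n) (k n)"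
    and close: "\<And>n x. x \<in> topspace X \<Longrightarrow> \<bar>\<phi> x - \<psi> (h n x)\<bar> < inverse (real (Suc n))"
  obtains f where "continuous_map X Y f" "inj_on f (topspace X)"
    "\<And>x. x \<in> topspace X \<Longrightarrow> \<psi> (f x) = \<phi> x"
proof -
  note X' = X(1)[unfolded size_pair_def] and Y' = Y(1)[unfolded size_pair_def]
  have compHaus: "compact_space X" "Hausdorff_space X" "compact_space Y" "Hausdorff_space Y"
    and cont: "continuous_map X euclideanreal \<phi>" "continuous_map Y euclideanreal \<psi>"
    using X' Y' by auto
  have hc: "continuous_map X Y (h n)" and kc: "continuous_map Y X (k n)" for n
    using hk by (auto simp: homeomorphic_maps_def)
  have hY: "h n x \<in> topspace Y" and kh: "k n (h n x) = x" if "x \<in> topspace X" for n x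
    using hk that hc[of n] by (auto simp: homeomorphic_maps_def continuous_map_def Pi_iff)
  have kX: "k n y \<in> topspace X" and hkid: "h n (k n y) = y" if "y \<in> topspace Y" for n y
    using hk that kc[of n] by (auto simp: homeomorphic_maps_def continuous_map_def Pi_iff)
  obtain f where f: "f \<in> topspace X \<rightarrow> topspace Y"
    and cluster: "\<And>n J V. finite J \<Longrightarrow> J \<subseteq> topspace X \<Longrightarrow>
       (\<And>i. i \<in> J \<Longrightarrow> openin Y (V i) \<and> f i \<in> V i) \<Longrightarrow> \<exists>m\<ge>n. \<forall>i\<in>J. h m i \<in> V i"
    using pointwise_cluster_map[of Y h "topspace X"] Y' hY by blast
  have cluster2: "\<exists>m. inverse (real (Suc m)) < e \<and> h m x \<in> V \<and> h m x' \<in> V'"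
    if "x \<in> topspace X" "x' \<in> topspace X" "openin Y V" "openin Y V'" "f x \<in> V" "f x' \<in> V'" "e > 0"
    for x x' V V' e
  proof -
    obtain n where n: "inverse (real (Suc n)) < e"
      using reals_Archimedean \<open>e > 0\<close> by blast
    \<comment> \<open>The constraint is an intersection because \<open>x\<close> and \<open>x'\<close> may coincide.\<close>
    have "\<exists>m\<ge>n. \<forall>i\<in>{x, x'}. h m i \<in> (if i = x then V else topspace Y) \<inter> (if i = x' then V' else topspace Y)"
      using that f by (intro cluster) auto
    then obtain m where m: "m \<ge> n" "h m x \<in> V" "h m x' \<in> V'"
      by auto
    have "inverse (real (Suc m)) \<le> inverse (real (Suc n))"
      using m(1) by (auto simp: field_simps)
    then show ?thesis using m n by (intro exI[of _ m] conjI; linarith?)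
  qed
  have level: "\<psi> (f x) = \<phi> x" if x: "x \<in> topspace X" for x
  proof -
    have "\<bar>\<psi> (f x) - \<phi> x\<bar> \<le> e" if "e > 0" for e
    proof -
      let ?B = "{y \<in> topspace Y. \<psi> y \<in> ball (\<psi> (f x)) (e/2)}"
      have "openin Y ?B"
        using Y' by (intro openin_continuous_map_preimage[of Y euclideanreal]) auto
      moreover have "f x \<in> ?B"
        using x f that by auto
      ultimately have "\<exists>m. inverse (real (Suc m)) < e/2 \<and> h m x \<in> ?B \<and> h m x \<in> ?B"
        using that by (intro cluster2[OF x x]) auto
      then obtain m where "inverse (real (Suc m)) < e/2" "h m x \<in> ?B"
        by (elim exE conjE)
      then have "\<bar>\<psi> (f x) - \<psi> (h m x)\<bar> < e/2" "inverse (real (Suc m)) < e/2"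
        by (auto simp: dist_real_def)
      then show ?thesis
        using close[OF x, of m] by linarith
    qed
    then have "\<bar>\<psi> (f x) - \<phi> x\<bar> \<le> 0"
      by (rule field_le_epsilon) simp
    then show ?thesis by simp
  qed
  have reg: "\<exists>W. openin Y W \<and> y \<in> W \<and> Y closure_of W \<subseteq> V" if "openin Y V" "y \<in> V" for V y
  proof -
    have "regular_space Y"
      using Y' compact_Hausdorff_imp_regular_space by blast
    then show ?thesis
      using that unfolding neighbourhood_base_of_closedin[symmetric] neighbourhood_base_of
      by (meson closure_of_minimal subset_trans)
  qed
  have nbhd: "\<exists>N. openin X N \<and> x \<in> N \<and> f ` N \<subseteq> V0"
    if x: "x \<in> topspace X" and V0: "openin Y V0" "f x \<in> V0" for x V0
  proof -
    \<comment> \<open>One shrinking, to \<open>V\<close>, is for the passage from \<open>h m\<close> to its cluster point \<open>f\<close>, the other, to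
      \<open>W\<close>, makes \<open>V\<close> and the complement of the closure of \<open>W\<close> a cover to which the previous section
      applies.\<close>
    obtain V where V: "openin Y V" "f x \<in> V" "Y closure_of V \<subseteq> V0"
      using reg[OF V0] by blast
    obtain W where W: "openin Y W" "f x \<in> W" "Y closure_of W \<subseteq> V"
      using reg[OF V(1,2)] by blast
    have W': "openin Y (topspace Y - Y closure_of W)"
      "topspace Y \<subseteq> V \<union> (topspace Y - Y closure_of W)"
      using W(3) by auto
    obtain d where d: "d > 0" "\<And>C. connectedin Y C \<Longrightarrow> (\<And>y. y \<in> C \<Longrightarrow> \<bar>\<psi> y - \<phi> x\<bar> < d) \<Longrightarrow>
        C \<subseteq> V \<or> C \<subseteq> topspace Y - Y closure_of W"
      using connected_near_fibre_subset_cover[OF compHaus(3,4) cont(2) Y(2)[of "\<phi> x"] V(1) W'] by blast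
    obtain N where N: "openin X N" "connectedin X N" "x \<in> N"
        "\<And>z. z \<in> N \<Longrightarrow> \<bar>\<phi> z - \<phi> x\<bar> < d/2"
      using connected_neighbourhood_small_oscillation[OF X(1) x, of "d/2"] d(1) by auto
    have NX: "N \<subseteq> topspace X"
      using N(1) by (rule openin_subset)
    have "f x' \<in> V0" if x': "x' \<in> N" for x'
    proof -
      have x'X: "x' \<in> topspace X" using NX x' by auto
      have "f x' \<in> Y closure_of V"
        unfolding in_closure_of
      proof (intro conjI allI impI)
        show "f x' \<in> topspace Y" using f x'X by auto
        fix V' assume V': "f x' \<in> V' \<and> openin Y V'"
        obtain m where m: "inverse (real (Suc m)) < d/2" "h m x \<in> W" "h m x' \<in> V'"
          using cluster2[OF x x'X W(1) _ W(2), of V' "d/2"] V' half_gt_zero[OF d(1)] by blast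
        have "connectedin Y (h m ` N)"
          using connectedin_continuous_map_image[OF hc N(2)] .
        moreover have "\<bar>\<psi> y - \<phi> x\<bar> < d" if y: "y \<in> h m ` N" for y
        proof -
          obtain z where z: "z \<in> N" "y = h m z" using y by blast
          then have "\<bar>\<phi> z - \<psi> y\<bar> < inverse (real (Suc m))" "\<bar>\<phi> z - \<phi> x\<bar> < d/2"
            using close N(4) NX by auto
          then show ?thesis using m(1) by linarith
        qed
        ultimately have "h m ` N \<subseteq> V \<or> h m ` N \<subseteq> topspace Y - Y closure_of W"
          by (rule d(2))
        moreover have "h m x \<in> Y closure_of W"
          using m(2) closure_of_subset[OF openin_subset[OF W(1)]] by (rule rev_subsetD)
        ultimately have "h m x' \<in> V"
          using N(3) x' by blast
        then show "\<exists>y. y \<in> V \<and> y \<in> V'" using m(3) by blast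
      qed
      then show ?thesis using V(3) by blast
    qed
    then show ?thesis using N(1,3) by blast
  qed
  have "continuous_map X Y f"
    unfolding continuous_map_def
  proof (intro conjI allI impI)
    fix V assume "openin Y V"
    show "openin X {x \<in> topspace X. f x \<in> V}"
    proof (subst openin_subopen, rule ballI)
      fix x assume "x \<in> {x \<in> topspace X. f x \<in> V}"
      then obtain N where "openin X N" "x \<in> N" "f ` N \<subseteq> V"
        using nbhd[OF _ \<open>openin Y V\<close>, of x] by blast
      moreover have "N \<subseteq> topspace X"
        using \<open>openin X N\<close> by (rule openin_subset)
      ultimately show "\<exists>N. openin X N \<and> x \<in> N \<and> N \<subseteq> {x \<in> topspace X. f x \<in> V}"
        by blast
    qed
  qed (rule f)
  moreover have "inj_on f (topspace X)"
  proof (rule inj_onI, rule ccontr)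
    fix x x' assume x: "x \<in> topspace X" "x' \<in> topspace X" "f x = f x'" "x \<noteq> x'"
    have "t1_space X" using X' Hausdorff_imp_t1_space by blast
    then have U: "openin X (topspace X - {x})" "openin X (topspace X - {x'})"
      using x by (auto intro!: openin_diff simp: closedin_t1_singleton)
    \<comment> \<open>No set that contains both \<open>x\<close> and \<open>x'\<close> lies in a member of this cover.\<close>
    have cover: "topspace X \<subseteq> (topspace X - {x}) \<union> (topspace X - {x'})"
      using x(4) by auto
    obtain d where d: "d > 0" "\<And>C. connectedin X C \<Longrightarrow> (\<And>z. z \<in> C \<Longrightarrow> \<bar>\<phi> z - \<phi> x\<bar> < d) \<Longrightarrow>
        C \<subseteq> topspace X - {x} \<or> C \<subseteq> topspace X - {x'}"
      using connected_near_fibre_subset_cover[OF compHaus(1,2) cont(1) X(2)[of "\<phi> x"] U cover] by blast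
    have "f x \<in> topspace Y"
      using x(1) f by auto
    then obtain N where N: "openin Y N" "connectedin Y N" "f x \<in> N"
        "\<And>y. y \<in> N \<Longrightarrow> \<bar>\<psi> y - \<phi> x\<bar> < d/2"
      using connected_neighbourhood_small_oscillation[OF Y(1), of "f x" "d/2"] d(1) level[OF x(1)]
      by auto
    have NY: "N \<subseteq> topspace Y"
      using N(1) by (rule openin_subset)
    obtain m where m: "inverse (real (Suc m)) < d/2" "h m x \<in> N" "h m x' \<in> N"
      using cluster2[OF x(1,2) N(1) N(1), of "d/2"] N(3) N(3)[unfolded x(3)] half_gt_zero[OF d(1)]
      by blast
    have "connectedin X (k m ` N)"
      using connectedin_continuous_map_image[OF kc N(2)] .
    moreover have "\<bar>\<phi> z - \<phi> x\<bar> < d" if z: "z \<in> k m ` N" for z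
    proof -
      obtain y where y: "y \<in> N" "z = k m y" using z by blast
      then have "\<bar>\<phi> z - \<psi> y\<bar> < inverse (real (Suc m))" "\<bar>\<psi> y - \<phi> x\<bar> < d/2"
        using close[of z m] N(4) NY kX hkid by auto
      then show ?thesis using m(1) by linarith
    qed
    ultimately have "k m ` N \<subseteq> topspace X - {x} \<or> k m ` N \<subseteq> topspace X - {x'}"
      by (rule d(2))
    moreover have "x \<in> k m ` N" "x' \<in> k m ` N"
      using imageI[OF m(2), of "k m"] imageI[OF m(3), of "k m"] kh x(1,2) by auto
    ultimately show False by blast
  qed
  ultimately show thesis using level by (rule that)
qed

text \<open>Surjectivity is a count: the embeddings in the two directions give injections
  between corresponding finite fibres, so each of them is onto.\<close>

lemma level_preserving_homeomorphism:
  fixes h :: "nat \<Rightarrow> 'a \<Rightarrow> 'b"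
  assumes X: "size_pair X \<phi>" "\<And>c. finite {x \<in> topspace X. \<phi> x = c}"
    and Y: "size_pair Y \<psi>" "\<And>c. finite {y \<in> topspace Y. \<psi> y = c}"
    and h: "\<And>n. homeomorphic_map X Y (h n)"
    and close: "\<And>n x. x \<in> topspace X \<Longrightarrow> \<bar>\<phi> x - \<psi> (h n x)\<bar> < inverse (real (Suc n))"
  obtains f where "homeomorphic_map X Y f" "\<And>x. x \<in> topspace X \<Longrightarrow> \<psi> (f x) = \<phi> x"
proof -
  obtain k where hk: "\<And>n. homeomorphic_maps X Y (h n) (k n)"
    using h unfolding homeomorphic_map_maps by metis
  obtain f where f: "continuous_map X Y f" "inj_on f (topspace X)"
    "\<And>x. x \<in> topspace X \<Longrightarrow> \<psi> (f x) = \<phi> x"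
    using level_preserving_embedding[OF X Y hk close] by blast
  have kh: "homeomorphic_maps Y X (k n) (h n)" for n
    using hk homeomorphic_maps_sym by blast
  have close': "\<bar>\<psi> y - \<phi> (k n y)\<bar> < inverse (real (Suc n))" if "y \<in> topspace Y" for n y
    using close[of "k n y" n] hk[of n] that
    by (auto simp: homeomorphic_maps_def continuous_map_def Pi_iff abs_minus_commute)
  obtain g where g: "continuous_map Y X g" "inj_on g (topspace Y)"
    "\<And>y. y \<in> topspace Y \<Longrightarrow> \<phi> (g y) = \<psi> y"
    using level_preserving_embedding[OF Y X kh close'] by blast
  have fY: "f ` topspace X \<subseteq> topspace Y" and gX: "g ` topspace Y \<subseteq> topspace X"
    using f(1) g(1) by (auto simp: continuous_map_def)
  have "y \<in> f ` topspace X" if y: "y \<in> topspace Y" for y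
  proof -
    let ?A = "{x \<in> topspace X. \<phi> x = \<psi> y}" and ?B = "{z \<in> topspace Y. \<psi> z = \<psi> y}"
    have fA: "f ` ?A \<subseteq> ?B" and gB: "g ` ?B \<subseteq> ?A"
      using fY gX f(3) g(3) by auto
    have "card ?B \<le> card ?A"
      by (rule card_inj_on_le[OF inj_on_subset[OF g(2)] gB]) (use X(2) in auto)
    also have "card ?A = card (f ` ?A)"
      by (rule card_image[symmetric], rule inj_on_subset[OF f(2)]) auto
    finally have "f ` ?A = ?B"
      using fA Y(2) by (intro card_seteq) auto
    then show ?thesis using y by blast
  qed
  then have "f ` topspace X = topspace Y"
    using fY by blast
  then have "homeomorphic_map X Y f"
    using f X(1) Y(1) unfolding size_pair_def
    by (intro continuous_imp_homeomorphic_map) auto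
  then show thesis using that f(3) by blast
qed

section \<open>Optimal homeomorphisms at distance zero\<close>

lemma natural_pseudo_distance_eq_0_imp_sequence:
  assumes X: "size_pair X \<phi>" and Y: "size_pair Y \<psi>"
    and 0: "natural_pseudo_distance X \<phi> Y \<psi> = 0"
  obtains h where "\<And>n. homeomorphic_map X Y (h n)"
    "\<And>n x. x \<in> topspace X \<Longrightarrow> \<bar>\<phi> x - \<psi> (h n x)\<bar> < inverse (real (Suc n))"
proof -
  have ne: "homeos X Y \<noteq> {}" and inf: "(INF f\<in>homeos X Y. Theta X \<phi> \<psi> f) = 0"
    using 0 by (auto simp: natural_pseudo_distance_def split: if_splits)
  have "\<exists>f\<in>homeos X Y. Theta X \<phi> \<psi> f < inverse (real (Suc n))" for n
  proof -
    have "(INF f\<in>homeos X Y. Theta X \<phi> \<psi> f) < inverse (real (Suc n))"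
      unfolding inf by simp
    then show ?thesis
      using cInf_lessD[of "Theta X \<phi> \<psi> ` homeos X Y"] ne by blast
  qed
  then obtain h where h: "\<And>n. h n \<in> homeos X Y" "\<And>n. Theta X \<phi> \<psi> (h n) < inverse (real (Suc n))"
    by metis
  have "\<bar>\<phi> x - \<psi> (h n x)\<bar> < inverse (real (Suc n))" if "x \<in> topspace X" for n x
  proof -
    have "\<bar>\<phi> x - \<psi> (h n x)\<bar> \<le> Theta X \<phi> \<psi> (h n)"
      using Theta_is_max[OF X Y h(1)[of n]] that by (elim bexE conjE) simp
    then show ?thesis using h(2)[of n] by linarith
  qed
  then show thesis using that[of h] h(1) by (simp add: homeos_def)
qed

theorem theorem3p5:
  fixes X :: "'a topology" and A :: "'a chart set" and \<phi> :: "'a \<Rightarrow> real"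
    and Y :: "'b topology" and B :: "'b chart set" and \<psi> :: "'b \<Rightarrow> real"
  assumes "size_pair X \<phi>" and "size_pair Y \<psi>"
    and "C2_closed_curve X A" and "C2_closed_curve Y B"
    and "Morse A \<phi>" and "Morse B \<psi>"
    and "natural_pseudo_distance X \<phi> Y \<psi> = 0"
  shows "\<exists>f. optimal_homeo X \<phi> Y \<psi> f \<and> Theta X \<phi> \<psi> f = 0"
proof -
  obtain h where h: "\<And>n. homeomorphic_map X Y (h n)"
    "\<And>n x. x \<in> topspace X \<Longrightarrow> \<bar>\<phi> x - \<psi> (h n x)\<bar> < inverse (real (Suc n))"
    using natural_pseudo_distance_eq_0_imp_sequence[OF assms(1,2,7)] by blast
  have fin: "finite {x \<in> topspace X. \<phi> x = c}" "finite {y \<in> topspace Y. \<psi> y = c}" for c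
    using assms(1-6) unfolding size_pair_def C2_closed_curve_def
    by (auto intro!: Morse_finite_fibres)
  obtain f where f: "homeomorphic_map X Y f" "\<And>x. x \<in> topspace X \<Longrightarrow> \<psi> (f x) = \<phi> x"
    using level_preserving_homeomorphism[OF assms(1) fin(1) assms(2) fin(2) h] by blast
  have "Theta X \<phi> \<psi> f = 0"
    using f(2) assms(1) by (simp add: Theta_def size_pair_def)
  then show ?thesis
    using f(1) assms(7) by (auto simp: optimal_homeo_def homeos_def zero_ereal_def)
qed

end
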